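(* Let $P(\lambda)=\sum_{i=0}^d\lambda^iA_i$ be a regular $n\times n$ matrix polynomial of degree $d$ with complex coefficients, and let $L(\lambda)=A-\lambda B$ be a linearization of $P(\lambda)$ satisfying properties P1 and P2. Let $(\lambda_0,x)$ and $(\widetilde\lambda_0,\widetilde x)$ be, respectively, exact and approximate eigenpairs of $P(\lambda)$. Let $\Omega$, $H(\lambda)$, $g(\lambda)$ be the region, right-sided factor and vector-valued function given by P1 and P2 for the eigenvalue $\lambda_0$, so that $\lambda_0\in\Omega$ and $L(\lambda)H(\lambda)=g(\lambda)\otimes P(\lambda)$ for $\lambda\in\Omega$. Assume that $x$ and $\widetilde x$ are unit vectors ($\|x\|_2=\|\widetilde x\|_2=1$) and that $\widetilde\lambda_0\in\Omega$. Suppose that the linearization $L(\lambda)=A-\lambda B$ has a generalized Schur form \[ Q^*BZ=\begin{bmatrix}\alpha & b^*\\ 0 & B_1\end{bmatrix}\quad\mbox{and}\quad Q^*AZ=\begin{bmatrix}\beta & a^*\\ 0 & A_1\end{bmatrix}\quad\mbox{with}\quad \lambda_0=\frac{\beta}{\alpha}, \] where $Q$ and $Z$ are unitary, $\alpha,\beta$ are scalars, and $A_1$ and $B_1$ are upper triangular. Then \[ \sin\angle(x,\widetilde x)\le \frac{\|g(\widetilde\lambda_0)\|_2\,\|P(\widetilde\lambda_0)\widetilde x\|_2}{\mathrm{sep}\,(\widetilde\lambda_0,(A_1,B_1))}. \]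
   Context: A matrix polynomial $P(\lambda)$ is regular if $\det P(\lambda)\not\equiv0$. An (exact) eigenpair of $P(\lambda)$ is a pair $(\lambda_0,x)$ with $x\neq0$ and $P(\lambda_0)x=0$; an approximate eigenpair is a given pair $(\widetilde\lambda_0,\widetilde x)\in\mathbb{C}\times\mathbb{C}^n$ regarded as an approximation of the exact eigenpair $(\lambda_0,x)$. A pencil is a matrix polynomial of degree at most 1. A linearization of an $n\times n$ matrix polynomial $P(\lambda)$ of degree $d$ is a $dn\times dn$ matrix pencil $L(\lambda)=A-\lambda B$ such that $U(\lambda)(A-\lambda B)V(\lambda)=\begin{bmatrix}P(\lambda)&0\\0&I_{(d-1)n}\end{bmatrix}$ for some unimodular matrix polynomials $U(\lambda),V(\lambda)$ (i.e. with nonzero constant determinant). $L(\lambda)$ is said to present a right-sided factorization at $\Omega\subseteq\mathbb{C}$ if $L(\lambda)H(\lambda)=g(\lambda)\otimes P(\lambda)$, for some matrix-valued function $H(\lambda)\in\mathbb{C}^{dn\times n}$ and some vector-valued function $g(\lambda)\in\mathbb{C}^d$ (not necessarily polynomial), where for each $\lambda\in\Omega$ the matrix $H(\lambda)$ has full column rank and $g(\lambda)\ne0$; $H(\lambda)$ is called a right-sided factor at $\Omega$. Property P1: for each eigenvalue $\lambda_0$ of $P(\lambda)$, $L(\lambda)$ presents a right-sided factorization $L(\lambda)H(\lambda)=g(\lambda)\otimes P(\lambda)$ at $\Omega$, for some complex region $\Omega$ that contains $\lambda_0$ and some right-sided factor $H(\lambda)$ at $\Omega$. Property P2: when the right-sided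 factor $H(\lambda)$ in P1 is partitioned into $d$ blocks $H_1(\lambda),\dots,H_d(\lambda)$ of size $n\times n$ (stacked vertically), $H_i(\lambda)=I_n$ for some $i\in\{1,\dots,d\}$. The acute angle between nonzero $u,w\in\mathbb{C}^n$ is $\angle(u,w):=\arccos\left(\frac{|w^*u|}{\|u\|_2\|w\|_2}\right)$. The separation is $\mathrm{sep}(\lambda,(A,B)):=\|(A-\lambda B)^{-1}\|_2^{-1}=\sigma_{\min}(A-\lambda B)$, the smallest singular value of $A-\lambda B$.
   Formalization: Added, as the claim fails for multiple eigenvalues: either λ₀ has only the eigenvector x up to scaling, or the first column of Z is a multiple of H(λ₀)x; also A₁−λ̃₀B₁ is assumed invertible and α nonzero, so that the quotients are defined. *)

theory Defs
  imports
    Complex_Main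
    "Jordan_Normal_Form.Schur_Decomposition"
    "Jordan_Normal_Form.Gauss_Jordan_Elimination"
    "Jordan_Normal_Form.DL_Rank"
begin

definition norm2 :: "complex vec \<Rightarrow> real" where
  "norm2 v = sqrt (\<Sum>i<dim_vec v. (cmod (v $ i))\<^sup>2)"

text \<open>The supremum ranges over the closed unit ball (not the unit sphere), so that a matrix
  without columns has norm 0.\<close>

definition spectral_norm :: "complex mat \<Rightarrow> real" where
  "spectral_norm M = Sup {norm2 (M *\<^sub>v v) | v. v \<in> carrier_vec (dim_col M) \<and> norm2 v \<le> 1}"

text \<open>\<open>w\<^sup>* u\<close> is \<open>u \<bullet>c w\<close>.\<close>

definition acute_angle :: "complex vec \<Rightarrow> complex vec \<Rightarrow> real" where
  "acute_angle u w = arccos (cmod (u \<bullet>c w) / (norm2 u * norm2 w))"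

text \<open>For singular \<open>A - z B\<close> the value is 0, the smallest singular value.\<close>

definition sep :: "complex \<Rightarrow> complex mat \<times> complex mat \<Rightarrow> real" where
  "sep z AB = (case mat_inverse (fst AB - z \<cdot>\<^sub>m snd AB) of
     None \<Rightarrow> 0 | Some C \<Rightarrow> inverse (spectral_norm C))"

definition unitary_mat :: "nat \<Rightarrow> complex mat \<Rightarrow> bool" where
  "unitary_mat N U \<longleftrightarrow> U \<in> carrier_mat N N \<and> mat_adjoint U * U = 1\<^sub>m N \<and> U * mat_adjoint U = 1\<^sub>m N"

text \<open>Matrix polynomials are matrices over \<open>complex poly\<close>.\<close>

definition matpoly :: "nat \<Rightarrow> nat \<Rightarrow> (nat \<Rightarrow> complex mat) \<Rightarrow> complex poly mat" where
  "matpoly n d C = mat n n (\<lambda>(i,j). \<Sum>k\<le>d. monom (C k $$ (i,j)) k)"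

definition eval_mat :: "complex poly mat \<Rightarrow> complex \<Rightarrow> complex mat" where
  "eval_mat P z = map_mat (\<lambda>p. poly p z) P"

definition pencil :: "complex mat \<Rightarrow> complex mat \<Rightarrow> complex poly mat" where
  "pencil A B = mat (dim_row A) (dim_col A) (\<lambda>(i,j). [:A $$ (i,j), - (B $$ (i,j)):])"

lemma eval_pencil:
  assumes "A \<in> carrier_mat m k" "B \<in> carrier_mat m k"
  shows "eval_mat (pencil A B) z = A - z \<cdot>\<^sub>m B"
  using assms by (intro eq_matI) (auto simp: eval_mat_def pencil_def)

definition regular_matpoly :: "complex poly mat \<Rightarrow> bool" where
  "regular_matpoly P \<longleftrightarrow> det P \<noteq> 0"

definition eigenpair :: "nat \<Rightarrow> complex poly mat \<Rightarrow> complex \<Rightarrow> complex vec \<Rightarrow> bool" where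
  "eigenpair n P z x \<longleftrightarrow> x \<in> carrier_vec n \<and> x \<noteq> 0\<^sub>v n \<and> eval_mat P z *\<^sub>v x = 0\<^sub>v n"

definition unimodular :: "nat \<Rightarrow> complex poly mat \<Rightarrow> bool" where
  "unimodular N U \<longleftrightarrow> U \<in> carrier_mat N N \<and> (\<exists>c. c \<noteq> 0 \<and> det U = [:c:])"

definition linearization ::
  "nat \<Rightarrow> nat \<Rightarrow> complex poly mat \<Rightarrow> complex mat \<Rightarrow> complex mat \<Rightarrow> bool" where
  "linearization n d P A B \<longleftrightarrow>
     A \<in> carrier_mat (d * n) (d * n) \<and> B \<in> carrier_mat (d * n) (d * n) \<and>
     (\<exists>U V. unimodular (d * n) U \<and> unimodular (d * n) V \<and>
        U * pencil A B * V =
          four_block_mat P (0\<^sub>m n ((d - 1) * n)) (0\<^sub>m ((d - 1) * n) n) (1\<^sub>m ((d - 1) * n)))"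

text \<open>Kronecker product of a column vector with a matrix: the blocks \<open>g\<^sub>i M\<close> stacked vertically.\<close>

definition kron_vec_mat :: "complex vec \<Rightarrow> complex mat \<Rightarrow> complex mat" where
  "kron_vec_mat g M = mat (dim_vec g * dim_row M) (dim_col M)
     (\<lambda>(r,c). g $ (r div dim_row M) * M $$ (r mod dim_row M, c))"

text \<open>\<open>\<Omega>\<close> is an arbitrary subset of the plane; no openness or connectedness is required of it.
  \<open>vec_space.rank N\<close> is the column rank of a matrix with \<open>N\<close> rows.\<close>

definition right_sided_factorization ::
  "nat \<Rightarrow> nat \<Rightarrow> complex poly mat \<Rightarrow> complex poly mat \<Rightarrow> complex set \<Rightarrow>
   (complex \<Rightarrow> complex mat) \<Rightarrow> (complex \<Rightarrow> complex vec) \<Rightarrow> bool" where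
  "right_sided_factorization n d L P \<Omega> H g \<longleftrightarrow>
     (\<forall>z\<in>\<Omega>. H z \<in> carrier_mat (d * n) n \<and> vec_space.rank (d * n) (H z) = n \<and>
             g z \<in> carrier_vec d \<and> g z \<noteq> 0\<^sub>v d \<and>
             eval_mat L z * H z = kron_vec_mat (g z) (eval_mat P z))"

definition row_block :: "nat \<Rightarrow> complex mat \<Rightarrow> nat \<Rightarrow> complex mat" where
  "row_block n M i = mat n n (\<lambda>(r,c). M $$ (i * n + r, c))"

text \<open>The index of the identity block does not depend on the point of \<open>\<Omega>\<close>.\<close>

definition has_identity_block ::
  "nat \<Rightarrow> nat \<Rightarrow> complex set \<Rightarrow> (complex \<Rightarrow> complex mat) \<Rightarrow> bool" where
  "has_identity_block n d \<Omega> H \<longleftrightarrow> (\<exists>i<d. \<forall>z\<in>\<Omega>. row_block n (H z) i = 1\<^sub>m n)"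

text \<open>Properties P1 and P2 are imposed together, since P2 speaks about the right-sided factor
  provided by P1.\<close>

definition P1_P2_data ::
  "nat \<Rightarrow> nat \<Rightarrow> complex poly mat \<Rightarrow> complex poly mat \<Rightarrow> complex \<Rightarrow> complex set \<Rightarrow>
   (complex \<Rightarrow> complex mat) \<Rightarrow> (complex \<Rightarrow> complex vec) \<Rightarrow> bool" where
  "P1_P2_data n d L P z0 \<Omega> H g \<longleftrightarrow>
     z0 \<in> \<Omega> \<and> right_sided_factorization n d L P \<Omega> H g \<and> has_identity_block n d \<Omega> H"

definition satisfies_P1_P2 ::
  "nat \<Rightarrow> nat \<Rightarrow> complex poly mat \<Rightarrow> complex poly mat \<Rightarrow> bool" where
  "satisfies_P1_P2 n d L P \<longleftrightarrow>
     (\<forall>z0. (\<exists>x. eigenpair n P z0 x) \<longrightarrow> (\<exists>\<Omega> H g. P1_P2_data n d L P z0 \<Omega> H g))"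

text \<open>The block matrix with rows \<open>(\<alpha>, b\<^sup>*)\<close> and \<open>(0, T)\<close>.\<close>

definition deflated_block :: "complex \<Rightarrow> complex vec \<Rightarrow> complex mat \<Rightarrow> complex mat" where
  "deflated_block \<alpha> b T =
     four_block_mat (mat 1 1 (\<lambda>_. \<alpha>)) (mat_of_rows (dim_vec b) [conjugate b])
                    (0\<^sub>m (dim_row T) 1) T"

definition generalized_schur_form ::
  "nat \<Rightarrow> complex mat \<Rightarrow> complex mat \<Rightarrow> complex mat \<Rightarrow> complex mat \<Rightarrow>
   complex \<Rightarrow> complex vec \<Rightarrow> complex mat \<Rightarrow> complex \<Rightarrow> complex vec \<Rightarrow> complex mat \<Rightarrow> bool" where
  "generalized_schur_form N A B Q Z \<beta> a A1 \<alpha> b B1 \<longleftrightarrow>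
     unitary_mat N Q \<and> unitary_mat N Z \<and>
     a \<in> carrier_vec (N - 1) \<and> A1 \<in> carrier_mat (N - 1) (N - 1) \<and> upper_triangular A1 \<and>
     b \<in> carrier_vec (N - 1) \<and> B1 \<in> carrier_mat (N - 1) (N - 1) \<and> upper_triangular B1 \<and>
     mat_adjoint Q * B * Z = deflated_block \<alpha> b B1 \<and>
     mat_adjoint Q * A * Z = deflated_block \<beta> a A1"

end

theory Submission
  imports Defs "HOL-Analysis.L2_Norm"
begin

text \<open>Let \<open>N = d n\<close>, let \<open>L(z) = A - z B\<close>, let \<open>z\<^sub>1\<close> be the first column of \<open>Z\<close> and let
  \<open>w = H(\<lambda>') x'\<close> be the vector that the right-sided factor makes out of the approximate
  eigenvector. The bound comes from estimating the distance from \<open>w\<close> to the line through \<open>z\<^sub>1\<close> from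
  both sides.

  From above: in the coordinates given by the unitary \<open>Q\<close> and \<open>Z\<close> the pencil is block upper
  triangular, so the last \<open>N - 1\<close> coordinates \<open>u\<close> of \<open>w\<close> satisfy
  \<open>(A\<^sub>1 - \<lambda>' B\<^sub>1) u = r\<close>, where \<open>r\<close> consists of the last coordinates of the residual
  \<open>L(\<lambda>') w\<close>. Therefore \<open>\<parallel>u\<parallel> \<le> \<parallel>L(\<lambda>') w\<parallel> / sep\<close>. Since \<open>Z\<close> is unitary,
  \<open>\<parallel>u\<parallel>\<close> is exactly the distance from \<open>w\<close> to the line (\<open>schur_residual_bound\<close>), and the
  factorization \<open>L H = g \<otimes> P\<close> turns the residual norm into
  \<open>\<parallel>g(\<lambda>')\<parallel> \<parallel>P(\<lambda>') x'\<parallel>\<close> (\<open>norm2_kron_vec_mat\<close>).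

  From below: \<open>z\<^sub>1\<close> is a multiple of \<open>H(\<lambda>\<^sub>0) x\<close>. This is either assumed, or it follows from
  the eigenspace of \<open>P\<close> being a line: \<open>z\<^sub>1\<close> and the nonzero vector \<open>H(\<lambda>\<^sub>0) x\<close> both lie in
  the kernel of \<open>L(\<lambda>\<^sub>0)\<close>, which the linearization property makes a line too
  (\<open>linearization_kernel_one_dim\<close>). Both \<open>H(\<lambda>')\<close> and \<open>H(\<lambda>\<^sub>0)\<close> have the identity in the
  same block, so that block of \<open>w - c H(\<lambda>\<^sub>0) x\<close> is \<open>x' - c x\<close>
  (\<open>norm2_identity_block_le\<close>), and no multiple of \<open>x\<close> is closer to \<open>x'\<close> than the sine of their
  angle (\<open>sin_acute_angle_le\<close>).\<close>

section \<open>The Euclidean and the spectral norm\<close>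

lemma norm2_eq_L2_set: "norm2 v = L2_set (\<lambda>i. cmod (v $ i)) {..<dim_vec v}"
  by (simp add: norm2_def L2_set_def)

lemma norm2_nonneg: "norm2 v \<ge> 0"
  by (simp add: norm2_eq_L2_set)

lemma norm2_eq_0_iff:
  assumes "v \<in> carrier_vec k"
  shows "norm2 v = 0 \<longleftrightarrow> v = 0\<^sub>v k"
  using assms by (auto simp: norm2_eq_L2_set L2_set_eq_0_iff intro!: eq_vecI)

lemma norm2_sq: "(norm2 v)\<^sup>2 = (\<Sum>i<dim_vec v. (cmod (v $ i))\<^sup>2)"
  by (simp add: norm2_def sum_nonneg)

lemma norm2_sq_eq_cscalar_prod: "complex_of_real ((norm2 v)\<^sup>2) = v \<bullet>c v"
  by (simp add: norm2_sq scalar_prod_def lessThan_atLeast0 complex_norm_square del: of_real_power)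

lemma norm2_smult: "norm2 (c \<cdot>\<^sub>v v) = cmod c * norm2 v"
  by (simp add: norm2_def norm_mult power_mult_distrib flip: sum_distrib_left real_sqrt_mult)
     (simp add: real_sqrt_mult)

text \<open>Restricting a vector to a row block and dropping its leading entry are both selections of
  entries along an injection, hence contractions.\<close>

lemma norm2_select_le:
  assumes "\<And>i. i < k \<Longrightarrow> f i < dim_vec v" and "inj_on f {..<k}"
  shows "norm2 (vec k (\<lambda>i. v $ f i)) \<le> norm2 v"
proof -
  have "(\<Sum>i<k. (cmod (v $ f i))\<^sup>2) = (\<Sum>j\<in>f ` {..<k}. (cmod (v $ j))\<^sup>2)"
    using assms(2) by (simp add: sum.reindex)
  also have "\<dots> \<le> (\<Sum>j<dim_vec v. (cmod (v $ j))\<^sup>2)"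
    using assms(1) by (intro sum_mono2) auto
  finally show ?thesis by (simp add: norm2_def)
qed

lemma norm2_vec_last_le:
  assumes "m \<le> dim_vec v"
  shows "norm2 (vec_last v m) \<le> norm2 v"
  unfolding vec_last_def using assms by (intro norm2_select_le) (auto simp: inj_on_def)

text \<open>A crude entrywise bound: its purpose is that the set of norms defining the spectral norm is
  bounded above, so that its supremum is meaningful.\<close>

lemma norm2_mult_mat_vec_bound:
  assumes "v \<in> carrier_vec (dim_col M)"
  shows "norm2 (M *\<^sub>v v) \<le> (\<Sum>i<dim_row M. \<Sum>j<dim_col M. cmod (M $$ (i,j))) * norm2 v"
proof -
  have entry: "cmod (v $ j) \<le> norm2 v" if "j < dim_col M" for j
    using member_le_L2_set[of "{..<dim_vec v}" j "\<lambda>i. cmod (v $ i)"] that assms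
    by (auto simp: norm2_eq_L2_set)
  have "norm2 (M *\<^sub>v v) \<le> (\<Sum>i<dim_row M. cmod ((M *\<^sub>v v) $ i))"
    using L2_set_le_sum_abs[of "\<lambda>i. cmod ((M *\<^sub>v v) $ i)" "{..<dim_row M}"]
    by (simp only: norm2_eq_L2_set dim_mult_mat_vec abs_norm_cancel)
  also have "\<dots> \<le> (\<Sum>i<dim_row M. \<Sum>j<dim_col M. cmod (M $$ (i,j)) * norm2 v)"
  proof (rule sum_mono)
    fix i assume "i \<in> {..<dim_row M}"
    then have "(M *\<^sub>v v) $ i = (\<Sum>j<dim_col M. M $$ (i,j) * v $ j)"
      using assms by (simp add: scalar_prod_def lessThan_atLeast0)
    then have "cmod ((M *\<^sub>v v) $ i) \<le> (\<Sum>j<dim_col M. cmod (M $$ (i,j)) * cmod (v $ j))"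
      by (simp add: norm_sum[THEN order_trans] norm_mult flip: norm_mult)
    also have "\<dots> \<le> (\<Sum>j<dim_col M. cmod (M $$ (i,j)) * norm2 v)"
      by (intro sum_mono mult_left_mono entry) auto
    finally show "cmod ((M *\<^sub>v v) $ i) \<le> \<dots>" .
  qed
  finally show ?thesis by (simp add: sum_distrib_right)
qed

lemma norm2_le_spectral_norm:
  assumes v: "v \<in> carrier_vec (dim_col M)" "norm2 v \<le> 1"
  shows "norm2 (M *\<^sub>v v) \<le> spectral_norm M"
proof -
  let ?S = "{norm2 (M *\<^sub>v v) | v. v \<in> carrier_vec (dim_col M) \<and> norm2 v \<le> 1}"
  let ?K = "\<Sum>i<dim_row M. \<Sum>j<dim_col M. cmod (M $$ (i,j))"
  have K: "?K \<ge> 0" by (intro sum_nonneg) auto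
  have "bdd_above ?S"
  proof (rule bdd_aboveI)
    fix r assume "r \<in> ?S"
    then obtain w where w: "w \<in> carrier_vec (dim_col M)" "norm2 w \<le> 1" "r = norm2 (M *\<^sub>v w)"
      by auto
    have "r \<le> ?K * norm2 w" using norm2_mult_mat_vec_bound[OF w(1)] w(3) by simp
    also have "\<dots> \<le> ?K * 1" using w(2) K by (rule mult_left_mono)
    finally show "r \<le> ?K * 1" .
  qed
  then show ?thesis
    unfolding spectral_norm_def using v by (intro cSup_upper) auto
qed

lemma sep_nonneg: "0 \<le> sep z (A, B)"
proof -
  have "0 \<le> spectral_norm M" for M
    using norm2_le_spectral_norm[of "0\<^sub>v (dim_col M)" M] norm2_nonneg[of "M *\<^sub>v 0\<^sub>v (dim_col M)"]
      norm2_eq_0_iff[of "0\<^sub>v (dim_col M)" "dim_col M"]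
    by simp
  then show ?thesis by (simp add: sep_def split: option.split)
qed

lemma norm2_mult_mat_vec_le:
  assumes "v \<in> carrier_vec (dim_col M)"
  shows "norm2 (M *\<^sub>v v) \<le> spectral_norm M * norm2 v"
proof (cases "norm2 v = 0")
  case True
  then show ?thesis using norm2_mult_mat_vec_bound[OF assms] by simp
next
  case False
  let ?u = "complex_of_real (inverse (norm2 v)) \<cdot>\<^sub>v v"
  have "?u \<in> carrier_vec (dim_col M)" "norm2 ?u \<le> 1"
    using assms False norm2_nonneg[of v] by (auto simp: norm2_smult norm_inverse)
  then have "norm2 (M *\<^sub>v ?u) \<le> spectral_norm M"
    by (rule norm2_le_spectral_norm)
  moreover have "M *\<^sub>v ?u = complex_of_real (inverse (norm2 v)) \<cdot>\<^sub>v (M *\<^sub>v v)"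
    using assms by (intro mult_mat_vec[of _ "dim_row M" "dim_col M"]) auto
  ultimately show ?thesis
    using False norm2_nonneg[of v] by (simp add: norm2_smult norm_inverse norm_divide field_simps)
qed

text \<open>The reciprocal \<open>inverse (sep z (A, B))\<close> is the spectral norm of the inverse of \<open>A - z B\<close>. This
  includes the empty matrix, whose inverse has spectral norm 0: the right-hand side is then a
  division by 0 and equals 0, as does the norm of the empty vector.\<close>

lemma norm2_le_div_sep:
  assumes A: "A \<in> carrier_mat m m" and B: "B \<in> carrier_mat m m" and v: "v \<in> carrier_vec m"
    and inv: "invertible_mat (A - z \<cdot>\<^sub>m B)"
  shows "norm2 v \<le> norm2 ((A - z \<cdot>\<^sub>m B) *\<^sub>v v) / sep z (A, B)"
proof -
  let ?M = "A - z \<cdot>\<^sub>m B"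
  have M: "?M \<in> carrier_mat m m" using A B by auto
  obtain X where X: "?M * X = 1\<^sub>m m" "X * ?M = 1\<^sub>m (dim_row X)"
    using inv M unfolding invertible_mat_def inverts_mat_def by auto
  have "dim_row X = m" "dim_col X = m"
    using arg_cong[OF X(1), of dim_col] arg_cong[OF X(2), of dim_col] M by auto
  then have "?M \<in> Units (ring_mat TYPE(complex) m ())"
    using X M unfolding Units_def ring_mat_def by auto
  then obtain Y where Y: "mat_inverse ?M = Some Y"
    using mat_inverse(1)[OF M] by fastforce
  have Y': "Y * ?M = 1\<^sub>m m" "Y \<in> carrier_mat m m"
    using mat_inverse(2)[OF M Y] by auto
  have "v = Y *\<^sub>v (?M *\<^sub>v v)"
    using assoc_mult_mat_vec[OF Y'(2) M v] Y'(1) v by simp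
  then have "norm2 v \<le> spectral_norm Y * norm2 (?M *\<^sub>v v)"
    using norm2_mult_mat_vec_le[of "?M *\<^sub>v v" Y] Y'(2) M v by auto
  then show ?thesis by (simp add: sep_def Y divide_inverse mult.commute)
qed

section \<open>Unitary matrices\<close>

lemma mat_adjoint_carrier:
  assumes "U \<in> carrier_mat k l"
  shows "mat_adjoint U \<in> carrier_mat l k"
  using assms by (auto simp: mat_adjoint_def)

lemma mat_adjoint_cscalar_prod:
  fixes U :: "complex mat"
  assumes U: "U \<in> carrier_mat k l" and u: "u \<in> carrier_vec k" and v: "v \<in> carrier_vec l"
  shows "(mat_adjoint U *\<^sub>v u) \<bullet>c v = u \<bullet>c (U *\<^sub>v v)"
proof -
  have "(mat_adjoint U *\<^sub>v u) \<bullet>c v = (\<Sum>j<l. (\<Sum>i<k. cnj (U $$ (i,j)) * u $ i) * cnj (v $ j))"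
    using U u v
    by (simp add: scalar_prod_def lessThan_atLeast0 mat_adjoint_def mat_of_rows_def)
  also have "\<dots> = (\<Sum>i<k. u $ i * cnj (\<Sum>j<l. U $$ (i,j) * v $ j))"
    by (simp add: sum_distrib_left sum_distrib_right mult_ac) (rule sum.swap)
  also have "\<dots> = u \<bullet>c (U *\<^sub>v v)"
    using U u v by (simp add: scalar_prod_def lessThan_atLeast0)
  finally show ?thesis .
qed

lemma norm2_isometry:
  assumes U: "U \<in> carrier_mat k l" and UU: "mat_adjoint U * U = 1\<^sub>m l" and v: "v \<in> carrier_vec l"
  shows "norm2 (U *\<^sub>v v) = norm2 v"
proof -
  have "(U *\<^sub>v v) \<bullet>c (U *\<^sub>v v) = (mat_adjoint U *\<^sub>v (U *\<^sub>v v)) \<bullet>c v"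
    using mat_adjoint_cscalar_prod[OF U _ v, of "U *\<^sub>v v"] U v by simp
  also have "mat_adjoint U *\<^sub>v (U *\<^sub>v v) = v"
    using assoc_mult_mat_vec[OF mat_adjoint_carrier[OF U] U v] UU v by simp
  finally have "complex_of_real ((norm2 (U *\<^sub>v v))\<^sup>2) = complex_of_real ((norm2 v)\<^sup>2)"
    by (simp only: norm2_sq_eq_cscalar_prod)
  then have "(norm2 (U *\<^sub>v v))\<^sup>2 = (norm2 v)\<^sup>2" by (simp only: of_real_eq_iff)
  then show ?thesis by (simp add: norm2_nonneg)
qed

lemma norm2_mat_adjoint_unitary:
  assumes U: "unitary_mat N U" and v: "v \<in> carrier_vec N"
  shows "norm2 (mat_adjoint U *\<^sub>v v) = norm2 v"
proof -
  have U': "U \<in> carrier_mat N N" "mat_adjoint U * U = 1\<^sub>m N" "U * mat_adjoint U = 1\<^sub>m N"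
    using U by (auto simp: unitary_mat_def)
  note Ua = mat_adjoint_carrier[OF U'(1)]
  have "norm2 (mat_adjoint U *\<^sub>v v) = norm2 (U *\<^sub>v (mat_adjoint U *\<^sub>v v))"
    using norm2_isometry[OF U'(1,2)] Ua v by simp
  also have "U *\<^sub>v (mat_adjoint U *\<^sub>v v) = v"
    using assoc_mult_mat_vec[OF U'(1) Ua v] U'(3) v by simp
  finally show ?thesis .
qed

section \<open>The sine of the angle as a distance\<close>

lemma norm2_diff_smult_sq:
  assumes u: "u \<in> carrier_vec k" and w: "w \<in> carrier_vec k"
  shows "(norm2 (w - c \<cdot>\<^sub>v u))\<^sup>2
    = (norm2 w)\<^sup>2 + (cmod c)\<^sup>2 * (norm2 u)\<^sup>2 - 2 * Re (cnj c * (w \<bullet>c u))"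
proof -
  have sq: "(cmod (s - c * t))\<^sup>2 = (cmod s)\<^sup>2 + (cmod c)\<^sup>2 * (cmod t)\<^sup>2 - 2 * Re (cnj c * (s * cnj t))"
    for s t
    unfolding cmod_power2 by (simp add: algebra_simps power2_eq_square)
  show ?thesis
    using u w
    by (simp add: norm2_sq sq sum.distrib sum_subtractf sum_distrib_left scalar_prod_def
        lessThan_atLeast0 Re_sum del: times_complex.sel)
qed

text \<open>For unit vectors the sine is the distance from \<open>w\<close> to the line through \<open>u\<close>: with
  \<open>s = u\<^sup>* w\<close>, completing the square gives
  \<open>\<parallel>w - c u\<parallel>\<^sup>2 = 1 - \<bar>s\<bar>\<^sup>2 + \<bar>c - s\<bar>\<^sup>2\<close>. The value at \<open>c = s\<close> yields
  \<open>\<bar>s\<bar> \<le> 1\<close>, which places \<open>\<bar>s\<bar>\<close> in the domain of \<open>arccos\<close>.\<close>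

lemma sin_acute_angle_le:
  assumes u: "u \<in> carrier_vec k" and w: "w \<in> carrier_vec k"
    and nu: "norm2 u = 1" and nw: "norm2 w = 1"
  shows "sin (acute_angle u w) \<le> norm2 (w - c \<cdot>\<^sub>v u)"
proof -
  define s where "s = w \<bullet>c u"
  have sym: "cmod (u \<bullet>c w) = cmod s"
  proof -
    have "u \<bullet>c w = cnj s"
      using u w by (simp add: s_def scalar_prod_def mult.commute)
    then show ?thesis by simp
  qed
  have ex: "(norm2 (w - t \<cdot>\<^sub>v u))\<^sup>2 = 1 - (cmod s)\<^sup>2 + (cmod (t - s))\<^sup>2" for t
    using norm2_diff_smult_sq[OF u w, of t] nu nw
    unfolding s_def[symmetric] cmod_power2 by (simp add: algebra_simps power2_eq_square)
  have "0 \<le> 1 - (cmod s)\<^sup>2"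
    using ex[of s] zero_le_power2[of "norm2 (w - s \<cdot>\<^sub>v u)"] by simp
  then have "cmod s \<le> 1" using power2_le_imp_le[of "cmod s" 1] by simp
  then have "sin (acute_angle u w) = sqrt (1 - (cmod s)\<^sup>2)"
    by (simp add: acute_angle_def nu nw sym sin_arccos order_trans[OF _ norm_ge_zero])
  also have "\<dots> \<le> sqrt ((norm2 (w - c \<cdot>\<^sub>v u))\<^sup>2)"
    unfolding ex by (intro real_sqrt_le_mono) simp
  also have "\<dots> = norm2 (w - c \<cdot>\<^sub>v u)" by (simp add: norm2_nonneg)
  finally show ?thesis .
qed

section \<open>The kernel of a linearization at an eigenvalue\<close>

lemma eval_mat_carrier:
  assumes "M \<in> carrier_mat k l"
  shows "eval_mat M z \<in> carrier_mat k l"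
  using assms by (simp add: eval_mat_def)

lemma eval_mat_mult:
  assumes "M \<in> carrier_mat k l" "M' \<in> carrier_mat l m"
  shows "eval_mat (M * M') z = eval_mat M z * eval_mat M' z"
proof -
  have "semiring_hom (\<lambda>p. poly p z)" by unfold_locales auto
  from semiring_hom.mat_hom_mult[OF this assms] show ?thesis by (simp add: eval_mat_def)
qed

lemma det_eval_mat: "det (eval_mat M z) = poly (det M) z"
proof -
  have "comm_ring_hom (\<lambda>p. poly p z)" by unfold_locales auto
  from comm_ring_hom.hom_det[OF this] show ?thesis by (simp add: eval_mat_def)
qed

lemma unimodular_eval_inverse:
  assumes "unimodular N V"
  obtains W where "W \<in> carrier_mat N N" "eval_mat V z * W = 1\<^sub>m N"
proof -
  obtain c where V: "V \<in> carrier_mat N N" and c: "c \<noteq> 0" "det V = [:c:]"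
    using assms by (auto simp: unimodular_def)
  have "det (eval_mat V z) \<noteq> 0" using c by (simp add: det_eval_mat)
  from det_non_zero_imp_unit[OF eval_mat_carrier[OF V] this, of "()"]
  show thesis using that by (auto simp: Units_def ring_mat_def)
qed

text \<open>Evaluated at \<open>z\<close>, the identity \<open>U L V = diag(P, I)\<close> says that the inverse of \<open>V(z)\<close>
  takes kernel vectors of \<open>L(z)\<close> to kernel vectors of \<open>diag(P(z), I)\<close>, which are kernel vectors
  of \<open>P(z)\<close> padded with zeros. Hence the kernel of \<open>L(z)\<close> lies in the line through the image under
  \<open>V(z)\<close> of the padded \<open>x\<close> as soon as that of \<open>P(z)\<close> lies in the line through \<open>x\<close>.\<close>

lemma linearization_kernel_one_dim:
  assumes lin: "linearization n d P A B" and P: "P \<in> carrier_mat n n" and d: "d \<ge> 1"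
    and x: "x \<in> carrier_vec n"
    and simple: "\<And>y. y \<in> carrier_vec n \<Longrightarrow> eval_mat P z *\<^sub>v y = 0\<^sub>v n \<Longrightarrow> \<exists>c. y = c \<cdot>\<^sub>v x"
  obtains k where "k \<in> carrier_vec (d * n)"
    and "\<And>v. v \<in> carrier_vec (d * n) \<Longrightarrow> (A - z \<cdot>\<^sub>m B) *\<^sub>v v = 0\<^sub>v (d * n) \<Longrightarrow> \<exists>c. v = c \<cdot>\<^sub>v k"
proof -
  let ?N = "d * n"
  define r where "r = (d - 1) * n"
  have N: "?N = n + r" using d unfolding r_def by (cases d) auto
  obtain U V where A: "A \<in> carrier_mat ?N ?N" and B: "B \<in> carrier_mat ?N ?N"
    and uni: "unimodular ?N U" "unimodular ?N V"
    and eq: "U * pencil A B * V = four_block_mat P (0\<^sub>m n r) (0\<^sub>m r n) (1\<^sub>m r)"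
    using lin unfolding linearization_def r_def by blast
  have U: "U \<in> carrier_mat ?N ?N" and V: "V \<in> carrier_mat ?N ?N"
    using uni by (auto simp: unimodular_def)
  have L: "pencil A B \<in> carrier_mat ?N ?N" using A B by (simp add: pencil_def)
  let ?U = "eval_mat U z" and ?V = "eval_mat V z" and ?P = "eval_mat P z" and ?L = "A - z \<cdot>\<^sub>m B"
  have U': "?U \<in> carrier_mat ?N ?N" and V': "?V \<in> carrier_mat ?N ?N" and P': "?P \<in> carrier_mat n n"
    using U V P by (auto intro: eval_mat_carrier)
  have L': "?L \<in> carrier_mat ?N ?N" using A B by auto
  have "eval_mat (four_block_mat P (0\<^sub>m n r) (0\<^sub>m r n) (1\<^sub>m r)) z
      = four_block_mat ?P (0\<^sub>m n r) (0\<^sub>m r n) (1\<^sub>m r)"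
    using P by (intro eq_matI) (auto simp: eval_mat_def)
  then have evaluated: "?U * ?L * ?V = four_block_mat ?P (0\<^sub>m n r) (0\<^sub>m r n) (1\<^sub>m r)"
    using eq eval_mat_mult[OF mult_carrier_mat[OF U L] V, of z] eval_mat_mult[OF U L, of z]
      eval_pencil[OF A B, of z] by simp
  obtain W where W: "W \<in> carrier_mat ?N ?N" "?V * W = 1\<^sub>m ?N"
    using unimodular_eval_inverse[OF uni(2)] by blast
  let ?k = "?V *\<^sub>v (x @\<^sub>v 0\<^sub>v r)"
  have x0: "x @\<^sub>v 0\<^sub>v r \<in> carrier_vec ?N" using x unfolding N by simp
  show thesis
  proof (rule that[of ?k])
    show "?k \<in> carrier_vec ?N" using V' x0 by simp
    fix v assume v: "v \<in> carrier_vec ?N" and ker: "?L *\<^sub>v v = 0\<^sub>v ?N"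
    let ?y = "W *\<^sub>v v" and ?y1 = "vec_first (W *\<^sub>v v) n" and ?y2 = "vec_last (W *\<^sub>v v) r"
    have y: "?y \<in> carrier_vec ?N" using W v by simp
    have Vy: "?V *\<^sub>v ?y = v" using assoc_mult_mat_vec[OF V' W(1) v] W(2) v by simp
    have split: "?y = ?y1 @\<^sub>v ?y2" using y unfolding N by simp
    have "(?U * ?L * ?V) *\<^sub>v ?y = ?U *\<^sub>v (?L *\<^sub>v (?V *\<^sub>v ?y))"
      using assoc_mult_mat_vec[OF mult_carrier_mat[OF U' L'] V' y]
        assoc_mult_mat_vec[OF U' L', of "?V *\<^sub>v ?y"] V' y by simp
    also have "\<dots> = 0\<^sub>v ?N" using U' unfolding Vy ker by auto
    finally have "four_block_mat ?P (0\<^sub>m n r) (0\<^sub>m r n) (1\<^sub>m r) *\<^sub>v (?y1 @\<^sub>v ?y2) = 0\<^sub>v (n + r)"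
      unfolding evaluated N by (simp add: split[symmetric, unfolded N])
    moreover have "four_block_mat ?P (0\<^sub>m n r) (0\<^sub>m r n) (1\<^sub>m r) *\<^sub>v (?y1 @\<^sub>v ?y2)
        = (?P *\<^sub>v ?y1) @\<^sub>v ?y2"
      using P' by (subst four_block_mat_mult_vec[of _ n n _ r _ r]) auto
    moreover have "0\<^sub>v (n + r) = 0\<^sub>v n @\<^sub>v 0\<^sub>v r" by (intro eq_vecI) auto
    ultimately have "(?P *\<^sub>v ?y1) @\<^sub>v ?y2 = 0\<^sub>v n @\<^sub>v 0\<^sub>v r" by simp
    then have y12: "?P *\<^sub>v ?y1 = 0\<^sub>v n" "?y2 = 0\<^sub>v r"
      using P' append_vec_eq[of "?P *\<^sub>v ?y1" n "0\<^sub>v n" ?y2 "0\<^sub>v r"] by auto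
    then obtain c where c: "?y1 = c \<cdot>\<^sub>v x" using simple[of ?y1] by auto
    have "?y = c \<cdot>\<^sub>v (x @\<^sub>v 0\<^sub>v r)"
      using split unfolding c y12(2) using x by (auto intro!: eq_vecI)
    then have "v = c \<cdot>\<^sub>v ?k" using Vy V' x0 mult_mat_vec[OF V' x0] by simp
    then show "\<exists>c. v = c \<cdot>\<^sub>v ?k" by blast
  qed
qed

section \<open>Right-sided factors\<close>

lemma sum_lessThan_mult:
  fixes f :: "nat \<Rightarrow> 'a :: comm_monoid_add"
  shows "(\<Sum>r<d * n. f r) = (\<Sum>i<d. \<Sum>j<n. f (i * n + j))"
proof -
  have "sum f {i * n..<i * n + n} = (\<Sum>j<n. f (i * n + j))" for i
    using sum.shift_bounds_nat_ivl[of f 0 "i * n" n] by (simp add: lessThan_atLeast0 add.commute)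
  then show ?thesis using sum.nat_group[of f n d] by simp
qed

lemma row_block_index_less:
  fixes i r n d :: nat
  assumes "i < d" "r < n"
  shows "i * n + r < d * n"
proof -
  have "i * n + r < Suc i * n" using assms by simp
  also have "\<dots> \<le> d * n" using assms by (intro mult_le_mono1) simp
  finally show ?thesis .
qed

text \<open>The norm is multiplicative because \<open>(g \<otimes> M) v\<close> is \<open>g \<otimes> (M v)\<close>, whose entries are
  all products of an entry of \<open>g\<close> with an entry of \<open>M v\<close>.\<close>

lemma norm2_kron_vec_mat:
  assumes g: "g \<in> carrier_vec d" and M: "M \<in> carrier_mat n k" and v: "v \<in> carrier_vec k"
  shows "norm2 (kron_vec_mat g M *\<^sub>v v) = norm2 g * norm2 (M *\<^sub>v v)"
proof -
  let ?w = "kron_vec_mat g M *\<^sub>v v"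
  have entry: "?w $ (i * n + j) = g $ i * (M *\<^sub>v v) $ j" if "i < d" "j < n" for i j
    using row_block_index_less[OF that] that g M v
    by (simp add: kron_vec_mat_def scalar_prod_def sum_distrib_left mult.assoc)
  have "(norm2 ?w)\<^sup>2 = (\<Sum>r<d * n. (cmod (?w $ r))\<^sup>2)"
    using g M by (simp add: norm2_sq kron_vec_mat_def)
  also have "\<dots> = (\<Sum>i<d. \<Sum>j<n. (cmod (g $ i))\<^sup>2 * (cmod ((M *\<^sub>v v) $ j))\<^sup>2)"
    unfolding sum_lessThan_mult
    by (intro sum.cong refl) (simp add: entry norm_mult power_mult_distrib)
  also have "\<dots> = (norm2 g * norm2 (M *\<^sub>v v))\<^sup>2"
    using g M by (simp add: norm2_sq power_mult_distrib sum_product)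
  finally show ?thesis by (simp add: norm2_nonneg)
qed

lemma row_block_select:
  assumes H: "H \<in> carrier_mat (d * n) n" and i: "i < d" and id: "row_block n H i = 1\<^sub>m n"
    and v: "v \<in> carrier_vec n"
  shows "vec n (\<lambda>r. (H *\<^sub>v v) $ (i * n + r)) = v"
proof -
  note lt = row_block_index_less[OF i]
  have "vec n (\<lambda>r. (H *\<^sub>v v) $ (i * n + r)) = row_block n H i *\<^sub>v v"
    using H v lt by (intro eq_vecI) (auto simp: row_block_def scalar_prod_def)
  then show ?thesis using id v by simp
qed

text \<open>The identity block makes distances in the large space dominate distances in \<open>\<complex>\<^sup>n\<close>,
  even though the two factors belong to different points of the region.\<close>

lemma norm2_identity_block_le:
  assumes H: "H \<in> carrier_mat (d * n) n" "H' \<in> carrier_mat (d * n) n" and i: "i < d"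
    and id: "row_block n H i = 1\<^sub>m n" "row_block n H' i = 1\<^sub>m n"
    and v: "v \<in> carrier_vec n" and v': "v' \<in> carrier_vec n"
  shows "norm2 (v' - c \<cdot>\<^sub>v v) \<le> norm2 (H' *\<^sub>v v' - c \<cdot>\<^sub>v (H *\<^sub>v v))"
proof -
  note lt = row_block_index_less[OF i]
  let ?w = "H' *\<^sub>v v' - c \<cdot>\<^sub>v (H *\<^sub>v v)"
  have "vec n (\<lambda>r. ?w $ (i * n + r)) $ r = (v' - c \<cdot>\<^sub>v v) $ r" if "r < n" for r
    using that lt[OF that] H v v' arg_cong[OF row_block_select[OF H(1) i id(1) v], of "\<lambda>u. u $ r"]
      arg_cong[OF row_block_select[OF H(2) i id(2) v'], of "\<lambda>u. u $ r"]
    by simp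
  then have "v' - c \<cdot>\<^sub>v v = vec n (\<lambda>r. ?w $ (i * n + r))"
    using v v' by (intro eq_vecI) auto
  then show ?thesis
    using lt H by (auto intro!: norm2_select_le simp: inj_on_def)
qed

section \<open>The deflated pencil\<close>

lemma deflated_block_carrier:
  assumes "T \<in> carrier_mat m m" "b \<in> carrier_vec m"
  shows "deflated_block \<alpha> b T \<in> carrier_mat (Suc m) (Suc m)"
  using assms by (auto simp: deflated_block_def)

lemma schur_pencil:
  assumes gs: "generalized_schur_form N A B Q Z \<beta> a A1 \<alpha> b B1"
    and A: "A \<in> carrier_mat N N" and B: "B \<in> carrier_mat N N"
  shows "mat_adjoint Q * (A - z \<cdot>\<^sub>m B) * Z = deflated_block \<beta> a A1 - z \<cdot>\<^sub>m deflated_block \<alpha> b B1"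
proof -
  have Z: "Z \<in> carrier_mat N N" and Q: "mat_adjoint Q \<in> carrier_mat N N"
    using gs by (auto simp: generalized_schur_form_def unitary_mat_def intro: mat_adjoint_carrier)
  have "mat_adjoint Q * (A - z \<cdot>\<^sub>m B) = mat_adjoint Q * A - z \<cdot>\<^sub>m (mat_adjoint Q * B)"
    using mult_minus_distrib_mat[OF Q A, of "z \<cdot>\<^sub>m B"] mult_smult_distrib[OF Q B] B by simp
  moreover have "(mat_adjoint Q * A - z \<cdot>\<^sub>m (mat_adjoint Q * B)) * Z
      = mat_adjoint Q * A * Z - z \<cdot>\<^sub>m (mat_adjoint Q * B * Z)"
    using minus_mult_distrib_mat[of "mat_adjoint Q * A" N N "z \<cdot>\<^sub>m (mat_adjoint Q * B)" Z N]
      mult_smult_assoc_mat[of "mat_adjoint Q * B" N N Z N z] Q A B Z by simp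
  ultimately show ?thesis using gs by (simp add: generalized_schur_form_def)
qed

lemma schur_pencil_mult_vec:
  assumes gs: "generalized_schur_form N A B Q Z \<beta> a A1 \<alpha> b B1"
    and A: "A \<in> carrier_mat N N" and B: "B \<in> carrier_mat N N" and u: "u \<in> carrier_vec N"
  shows "mat_adjoint Q *\<^sub>v ((A - z \<cdot>\<^sub>m B) *\<^sub>v (Z *\<^sub>v u))
    = (deflated_block \<beta> a A1 - z \<cdot>\<^sub>m deflated_block \<alpha> b B1) *\<^sub>v u"
proof -
  have Z: "Z \<in> carrier_mat N N" and Q: "mat_adjoint Q \<in> carrier_mat N N"
    using gs by (auto simp: generalized_schur_form_def unitary_mat_def intro: mat_adjoint_carrier)
  have L: "A - z \<cdot>\<^sub>m B \<in> carrier_mat N N" using A B by auto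
  show ?thesis
    unfolding schur_pencil[OF gs A B, symmetric]
    using assoc_mult_mat_vec[OF mult_carrier_mat[OF Q L] Z u]
      assoc_mult_mat_vec[OF Q L, of "Z *\<^sub>v u"] Z u by simp
qed

lemma col_eq_mult_unit_vec:
  fixes M :: "'a :: semiring_1 mat"
  assumes "M \<in> carrier_mat k l" "j < l"
  shows "col M j = M *\<^sub>v unit_vec l j"
  using assms by (intro eq_vecI) auto

text \<open>When \<open>z\<close> is the ratio of the leading entries, the leading entry \<open>\<beta> - z \<alpha>\<close> of the
  deflated pencil vanishes, and with it the whole first column.\<close>

lemma schur_first_column_kernel:
  assumes gs: "generalized_schur_form N A B Q Z \<beta> a A1 \<alpha> b B1" and N: "N > 0"
    and A: "A \<in> carrier_mat N N" and B: "B \<in> carrier_mat N N" and ev: "\<beta> = z * \<alpha>"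
  shows "(A - z \<cdot>\<^sub>m B) *\<^sub>v col Z 0 = 0\<^sub>v N"
proof -
  let ?D = "deflated_block \<beta> a A1 - z \<cdot>\<^sub>m deflated_block \<alpha> b B1"
  let ?v = "(A - z \<cdot>\<^sub>m B) *\<^sub>v col Z 0"
  obtain m where m: "N = Suc m" using N by (cases N) auto
  have Q: "unitary_mat N Q" and Z: "Z \<in> carrier_mat N N"
    using gs by (auto simp: generalized_schur_form_def unitary_mat_def)
  have A1: "A1 \<in> carrier_mat m m" "a \<in> carrier_vec m" "B1 \<in> carrier_mat m m" "b \<in> carrier_vec m"
    using gs m by (auto simp: generalized_schur_form_def)
  have D: "?D \<in> carrier_mat N N"
    using A1 m by (auto intro!: minus_carrier_mat smult_carrier_mat deflated_block_carrier)
  have v: "?v \<in> carrier_vec N"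
    using A B Z by (intro mult_mat_vec_carrier[of _ N N]) auto
  have "mat_adjoint Q *\<^sub>v ?v = ?D *\<^sub>v unit_vec N 0"
    using schur_pencil_mult_vec[OF gs A B, of "unit_vec N 0"] col_eq_mult_unit_vec[OF Z N] by simp
  also have "\<dots> = col ?D 0" using col_eq_mult_unit_vec[OF D N] by simp
  also have "\<dots> = 0\<^sub>v N"
    using D A1 m ev by (intro eq_vecI) (auto simp: deflated_block_def)
  finally have "norm2 ?v = 0"
    using norm2_mat_adjoint_unitary[OF Q v] norm2_eq_0_iff[of "0\<^sub>v N" N] by simp
  then show ?thesis using norm2_eq_0_iff[OF v] by simp
qed

text \<open>The lower left block of the Schur form vanishes, so the trailing entries of the image of
  \<open>u\<close> depend only on those of \<open>u\<close>.\<close>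

lemma vec_last_deflated_mult:
  assumes "A1 \<in> carrier_mat m m" "B1 \<in> carrier_mat m m" "a \<in> carrier_vec m" "b \<in> carrier_vec m"
    and "u \<in> carrier_vec (Suc m)"
  shows "vec_last ((deflated_block \<beta> a A1 - z \<cdot>\<^sub>m deflated_block \<alpha> b B1) *\<^sub>v u) m
    = (A1 - z \<cdot>\<^sub>m B1) *\<^sub>v vec_last u m"
proof (rule eq_vecI)
  let ?D = "deflated_block \<beta> a A1 - z \<cdot>\<^sub>m deflated_block \<alpha> b B1"
  fix i assume "i < dim_vec ((A1 - z \<cdot>\<^sub>m B1) *\<^sub>v vec_last u m)"
  then have i: "i < m" using assms by simp
  have D: "?D \<in> carrier_mat (Suc m) (Suc m)"
    using assms by (auto intro!: minus_carrier_mat smult_carrier_mat deflated_block_carrier)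
  have lead: "?D $$ (Suc i, 0) = 0"
    using i assms by (simp add: deflated_block_def)
  have tail: "?D $$ (Suc i, Suc j) = (A1 - z \<cdot>\<^sub>m B1) $$ (i, j)" if "j < m" for j
    using i that assms by (simp add: deflated_block_def)
  have "vec_last (?D *\<^sub>v u) m $ i = (\<Sum>j<Suc m. ?D $$ (Suc i, j) * u $ j)"
    using D i assms by (simp add: vec_last_def scalar_prod_def lessThan_atLeast0 del: index_minus_mat)
  also have "\<dots> = (\<Sum>j<m. (A1 - z \<cdot>\<^sub>m B1) $$ (i, j) * u $ Suc j)"
    unfolding sum.lessThan_Suc_shift by (simp add: lead tail del: index_minus_mat)
  also have "\<dots> = ((A1 - z \<cdot>\<^sub>m B1) *\<^sub>v vec_last u m) $ i"
    using i assms by (simp add: vec_last_def scalar_prod_def lessThan_atLeast0)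
  finally show "vec_last (?D *\<^sub>v u) m $ i = ((A1 - z \<cdot>\<^sub>m B1) *\<^sub>v vec_last u m) $ i" .
qed (use assms in simp)

text \<open>In the orthonormal basis given by the columns of \<open>Z\<close>, dropping the first coordinate of
  \<open>w\<close> means subtracting a multiple of the first column.\<close>

lemma norm2_vec_last_unitary:
  assumes Z: "unitary_mat N Z" and N: "N > 0" and w: "w \<in> carrier_vec N"
  obtains c where "norm2 (vec_last (mat_adjoint Z *\<^sub>v w) (N - 1)) = norm2 (w - c \<cdot>\<^sub>v col Z 0)"
proof -
  obtain m where m: "N = Suc m" using N by (cases N) auto
  have Z': "Z \<in> carrier_mat N N" "mat_adjoint Z * Z = 1\<^sub>m N" "Z * mat_adjoint Z = 1\<^sub>m N"
    using Z by (auto simp: unitary_mat_def)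
  let ?u = "mat_adjoint Z *\<^sub>v w"
  let ?c = "?u $ 0"
  let ?t = "?u - ?c \<cdot>\<^sub>v unit_vec N 0"
  have u: "?u \<in> carrier_vec N" using mat_adjoint_carrier[OF Z'(1)] w by simp
  have e: "unit_vec N 0 \<in> carrier_vec N" by simp
  have t: "?t \<in> carrier_vec N" using u by simp
  have "Z *\<^sub>v ?u = w"
    using assoc_mult_mat_vec[OF Z'(1) mat_adjoint_carrier[OF Z'(1)] w] Z'(3) w by simp
  then have "Z *\<^sub>v ?t = w - ?c \<cdot>\<^sub>v col Z 0"
    using mult_minus_distrib_mat_vec[OF Z'(1) u, of "?c \<cdot>\<^sub>v unit_vec N 0"]
      mult_mat_vec[OF Z'(1) e] col_eq_mult_unit_vec[OF Z'(1) N] by simp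
  then have "norm2 (w - ?c \<cdot>\<^sub>v col Z 0) = norm2 ?t"
    using norm2_isometry[OF Z'(1,2) t] by simp
  also have "\<dots> = norm2 (vec_last ?u m)"
    using carrier_vecD[OF u] m
    by (simp add: norm2_def sum.lessThan_Suc_shift vec_last_def del: dim_mult_mat_vec sum.lessThan_Suc)
  finally show thesis using that[of ?c] m by simp
qed

text \<open>An a posteriori bound for an arbitrary vector \<open>w\<close>: its residual controls its distance from
  the deflating direction.\<close>

lemma schur_residual_bound:
  assumes gs: "generalized_schur_form N A B Q Z \<beta> a A1 \<alpha> b B1" and N: "N > 0"
    and A: "A \<in> carrier_mat N N" and B: "B \<in> carrier_mat N N" and w: "w \<in> carrier_vec N"
    and inv: "invertible_mat (A1 - z \<cdot>\<^sub>m B1)"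
  obtains c where "norm2 (w - c \<cdot>\<^sub>v col Z 0) \<le> norm2 ((A - z \<cdot>\<^sub>m B) *\<^sub>v w) / sep z (A1, B1)"
proof -
  obtain m where m: "N = Suc m" using N by (cases N) auto
  have Q: "unitary_mat N Q" and Z: "unitary_mat N Z"
    using gs by (auto simp: generalized_schur_form_def)
  have blocks: "A1 \<in> carrier_mat m m" "B1 \<in> carrier_mat m m" "a \<in> carrier_vec m" "b \<in> carrier_vec m"
    using gs m by (auto simp: generalized_schur_form_def)
  have Z': "Z \<in> carrier_mat N N" "Z * mat_adjoint Z = 1\<^sub>m N"
    using Z by (auto simp: unitary_mat_def)
  let ?u = "mat_adjoint Z *\<^sub>v w" and ?r = "(A - z \<cdot>\<^sub>m B) *\<^sub>v w"
  have u: "?u \<in> carrier_vec N" using mat_adjoint_carrier[OF Z'(1)] w by simp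
  have r: "?r \<in> carrier_vec N"
    using A B w by (intro mult_mat_vec_carrier[of _ N N]) auto
  have Zu: "Z *\<^sub>v ?u = w"
    using assoc_mult_mat_vec[OF Z'(1) mat_adjoint_carrier[OF Z'(1)] w] Z'(2) w by simp
  have Qr: "(A1 - z \<cdot>\<^sub>m B1) *\<^sub>v vec_last ?u m = vec_last (mat_adjoint Q *\<^sub>v ?r) m"
    using schur_pencil_mult_vec[OF gs A B u, of z] vec_last_deflated_mult[OF blocks, of ?u \<beta> z \<alpha>] u m Zu
    by simp
  have "norm2 (vec_last ?u m) \<le> norm2 ((A1 - z \<cdot>\<^sub>m B1) *\<^sub>v vec_last ?u m) / sep z (A1, B1)"
    using norm2_le_div_sep[OF blocks(1,2) _ inv] by simp
  also have "\<dots> \<le> norm2 ?r / sep z (A1, B1)"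
  proof (rule divide_right_mono)
    have dim: "dim_vec (mat_adjoint Q *\<^sub>v ?r) = N"
      using Q mat_adjoint_carrier[of Q N N] by (auto simp: unitary_mat_def)
    show "norm2 ((A1 - z \<cdot>\<^sub>m B1) *\<^sub>v vec_last ?u m) \<le> norm2 ?r"
      unfolding Qr norm2_mat_adjoint_unitary[OF Q r, symmetric]
      using dim m by (intro norm2_vec_last_le) simp
    show "0 \<le> sep z (A1, B1)" by (rule sep_nonneg)
  qed
  finally have "norm2 (vec_last ?u (N - 1)) \<le> norm2 ?r / sep z (A1, B1)" using m by simp
  then show thesis
    using norm2_vec_last_unitary[OF Z N w] that by metis
qed

section \<open>The angle bound\<close>

theorem theorem4p1:
  fixes n d :: nat
    and C :: "nat \<Rightarrow> complex mat"
    and P :: "complex poly mat"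
    and A B Q Z A1 B1 :: "complex mat"
    and a b x x' :: "complex vec"
    and lam0 lam' \<alpha> \<beta> :: complex
    and \<Omega> :: "complex set"
    and H :: "complex \<Rightarrow> complex mat"
    and g :: "complex \<Rightarrow> complex vec"
  assumes "n \<ge> 1" and "d \<ge> 1"
    and "\<And>k. k \<le> d \<Longrightarrow> C k \<in> carrier_mat n n"
    and "C d \<noteq> 0\<^sub>m n n"
    and "P = matpoly n d C"
    and "regular_matpoly P"
    and "linearization n d P A B"
    and "satisfies_P1_P2 n d (pencil A B) P"
    and "eigenpair n P lam0 x"
    and "x' \<in> carrier_vec n"
    and "norm2 x = 1" and "norm2 x' = 1"
    and "P1_P2_data n d (pencil A B) P lam0 \<Omega> H g"
    and "lam' \<in> \<Omega>"
    and "generalized_schur_form (d * n) A B Q Z \<beta> a A1 \<alpha> b B1"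
    and "\<alpha> \<noteq> 0" and "lam0 = \<beta> / \<alpha>"
    and "(\<forall>y. eigenpair n P lam0 y \<longrightarrow> (\<exists>c. y = c \<cdot>\<^sub>v x))
         \<or> (\<exists>c. col Z 0 = c \<cdot>\<^sub>v (H lam0 *\<^sub>v x))"
    and "invertible_mat (A1 - lam' \<cdot>\<^sub>m B1)"
  shows "sin (acute_angle x x')
         \<le> norm2 (g lam') * norm2 (eval_mat P lam' *\<^sub>v x') / sep lam' (A1, B1)"
proof -
  let ?N = "d * n"
  note n = assms(1) and d = assms(2) and lin = assms(7) and gs = assms(15)
  have N: "?N > 0" using n d by simp
  have P: "P \<in> carrier_mat n n" by (simp add: assms(5) matpoly_def)
  have Pe: "eval_mat P z \<in> carrier_mat n n" for z using P by (rule eval_mat_carrier)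
  have A: "A \<in> carrier_mat ?N ?N" and B: "B \<in> carrier_mat ?N ?N"
    using lin by (auto simp: linearization_def)
  have x: "x \<in> carrier_vec n" "eval_mat P lam0 *\<^sub>v x = 0\<^sub>v n"
    using assms(9) by (auto simp: eigenpair_def)
  note x' = assms(10)
  have om: "lam0 \<in> \<Omega>" and rsf: "right_sided_factorization n d (pencil A B) P \<Omega> H g"
    and idb: "has_identity_block n d \<Omega> H"
    using assms(13) by (auto simp: P1_P2_data_def)
  have H: "H z \<in> carrier_mat ?N n" and gc: "g z \<in> carrier_vec d"
    and fact: "(A - z \<cdot>\<^sub>m B) * H z = kron_vec_mat (g z) (eval_mat P z)" if "z \<in> \<Omega>" for z
    using rsf that by (auto simp: right_sided_factorization_def eval_pencil[OF A B])
  have L: "A - z \<cdot>\<^sub>m B \<in> carrier_mat ?N ?N" for z using A B by auto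
  have residual: "norm2 ((A - z \<cdot>\<^sub>m B) *\<^sub>v (H z *\<^sub>v v)) = norm2 (g z) * norm2 (eval_mat P z *\<^sub>v v)"
    if "z \<in> \<Omega>" "v \<in> carrier_vec n" for z v
    using assoc_mult_mat_vec[OF L[of z] H[OF that(1)] that(2)] fact[OF that(1)]
      norm2_kron_vec_mat[OF gc[OF that(1)] Pe[of z] that(2)] by simp
  obtain i where i: "i < d" "\<And>z. z \<in> \<Omega> \<Longrightarrow> row_block n (H z) i = 1\<^sub>m n"
    using idb by (auto simp: has_identity_block_def)
  let ?h = "H lam0 *\<^sub>v x" and ?w = "H lam' *\<^sub>v x'"
  have h: "?h \<in> carrier_vec ?N" and w: "?w \<in> carrier_vec ?N"
    using mult_mat_vec_carrier[OF H[OF om] x(1)] mult_mat_vec_carrier[OF H[OF assms(14)] x'] .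
  have z1: "\<exists>c. col Z 0 = c \<cdot>\<^sub>v ?h"
    using assms(18)
  proof
    assume simple: "\<forall>y. eigenpair n P lam0 y \<longrightarrow> (\<exists>c. y = c \<cdot>\<^sub>v x)"
    have "\<exists>c. y = c \<cdot>\<^sub>v x" if "y \<in> carrier_vec n" "eval_mat P lam0 *\<^sub>v y = 0\<^sub>v n" for y
    proof (cases "y = 0\<^sub>v n")
      case True
      then have "y = 0 \<cdot>\<^sub>v x" using x by auto
      then show ?thesis by blast
    next
      case False
      then show ?thesis using simple that by (auto simp: eigenpair_def)
    qed
    then obtain k where k: "k \<in> carrier_vec ?N"
      and ker: "\<And>v. v \<in> carrier_vec ?N \<Longrightarrow> (A - lam0 \<cdot>\<^sub>m B) *\<^sub>v v = 0\<^sub>v ?N \<Longrightarrow> \<exists>c. v = c \<cdot>\<^sub>v k"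
      using linearization_kernel_one_dim[OF lin P d x(1)] by blast
    have "\<beta> = lam0 * \<alpha>" using assms(16,17) by simp
    then have "(A - lam0 \<cdot>\<^sub>m B) *\<^sub>v col Z 0 = 0\<^sub>v ?N"
      by (rule schur_first_column_kernel[OF gs N A B])
    moreover have "col Z 0 \<in> carrier_vec ?N"
      using gs by (intro col_carrier_vec[OF N]) (simp add: generalized_schur_form_def unitary_mat_def)
    ultimately obtain c where c: "col Z 0 = c \<cdot>\<^sub>v k" using ker by blast
    have "norm2 ((A - lam0 \<cdot>\<^sub>m B) *\<^sub>v ?h) = 0"
      using residual[OF om x(1)] x(2) norm2_eq_0_iff[of "0\<^sub>v n" n] by simp
    then have "(A - lam0 \<cdot>\<^sub>m B) *\<^sub>v ?h = 0\<^sub>v ?N"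
      using norm2_eq_0_iff[OF mult_mat_vec_carrier[OF L h]] by blast
    then obtain c' where c': "?h = c' \<cdot>\<^sub>v k" using ker[OF h] by blast
    \<comment> \<open>\<open>x\<close> is a block of \<open>?h\<close>, so \<open>?h\<close> does not vanish.\<close>
    have "c' \<noteq> 0"
    proof
      assume "c' = 0"
      then have "?h = 0\<^sub>v ?N" using c' k by auto
      moreover have "vec n (\<lambda>r. ?h $ (i * n + r)) = x"
        by (rule row_block_select[OF H[OF om] i(1) i(2)[OF om] x(1)])
      moreover have "norm2 (vec n (\<lambda>r. ?h $ (i * n + r))) \<le> norm2 ?h"
        using row_block_index_less[OF i(1)] H[OF om]
        by (intro norm2_select_le) (auto simp: inj_on_def)
      ultimately show False
        using assms(11) norm2_eq_0_iff[of "0\<^sub>v ?N" ?N] by simp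
    qed
    then have "col Z 0 = (c / c') \<cdot>\<^sub>v ?h"
      unfolding c c' by (simp add: smult_smult_assoc)
    then show ?thesis by blast
  qed
  then obtain c where c: "col Z 0 = c \<cdot>\<^sub>v ?h" by blast
  obtain e where e: "norm2 (?w - e \<cdot>\<^sub>v col Z 0)
      \<le> norm2 ((A - lam' \<cdot>\<^sub>m B) *\<^sub>v ?w) / sep lam' (A1, B1)"
    using schur_residual_bound[OF gs N A B w assms(19)] by blast
  have "sin (acute_angle x x') \<le> norm2 (x' - (e * c) \<cdot>\<^sub>v x)"
    by (rule sin_acute_angle_le[OF x(1) x' assms(11,12)])
  also have "\<dots> \<le> norm2 (?w - (e * c) \<cdot>\<^sub>v ?h)"
    by (rule norm2_identity_block_le[OF H[OF om] H[OF assms(14)] i(1) i(2)[OF om]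
          i(2)[OF assms(14)] x(1) x'])
  also have "\<dots> = norm2 (?w - e \<cdot>\<^sub>v col Z 0)" by (simp add: c smult_smult_assoc)
  also note e
  also note residual[OF assms(14) x']
  finally show ?thesis .
qed

end
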